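(* Let $\dot G=(G,\sigma)$ be a $\mathcal{K}_4^-$-free unbalanced signed graph of order $n$. Then $$\rho(\dot G)\leqslant n-2,$$ with equality holding if and only if $\dot G\sim\dot G_1(0,n-3)$.
   Context: All graphs are finite, simple and undirected. A signed graph $\dot G=(G,\sigma)$ consists of a graph $G$ (the underlying graph) and a sign function $\sigma:E(G)\to\{-1,+1\}$. The sign of a cycle is the product of the signs of its edges; a cycle is positive or negative accordingly. $\dot G$ is balanced if all its cycles are positive, and unbalanced otherwise. For $U\subseteq V(G)$, $\dot G_U$ is obtained from $\dot G$ by reversing the sign of every edge between $U$ and $V(G)\setminus U$; $\dot G_U$ is called switching equivalent to $\dot G$, written $\dot G\sim\dot G_U$ (statements $\dot G\sim\dot H$ are understood up to sign-preserving isomorphism of signed graphs). The adjacency matrix $A(\dot G)=(a_{xy})$ is the symmetric matrix with $a_{xy}=\sigma(xy)$ if $xy$ is an edge and $a_{xy}=0$ otherwise; its eigenvalues are $\lambda_1(\dot G)\geqslant\cdots\geqslant\lambda_n(\dot G)$, and the spectral radius is $\rho(\dot G)=\max\{|\lambda_i(\dot G)|:1\leqslant i\leqslant n\}=\max\{\lambda_1(\dot G),-\lambda_n(\dot G)\}$. $\mathcal{K}_4^-$ is the set of all unbalanced signed graphs whose underlying graph is $K_4$; $\dot G$ is $\mathcal{K}_4^-$-free if it contains no member of $\mathcal{K}_4^-$ as a (signed) subgraph. $\dot G_1(0,n-3)$ is the signed graph of order $n$ with vertex set $\{u,v,w\}\cup B$ (disjoint), $|B|=n-3$, in which all pairs of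 vertices are adjacent except that $u$ is not adjacent to any vertex of $B$; the edge $uv$ is negative and all other edges are positive.
   Formalization: The formal theorem assumes n ≥ 7: with all edges negative, K_3, K_4 minus an edge and K_{2,2,1} violate the bound for n = 3, 4, 5, and for n = 6 K_{2,2,2} has spectral radius n−2 but is not switching equivalent to G_1(0,3). *)

theory Defs
  imports "Jordan_Normal_Form.Spectral_Radius"
begin

text \<open>The values of \<open>sigma\<close> outside \<open>edges\<close> carry no meaning; no definition below depends on them.\<close>

record 'a signed_graph =
  verts :: "'a set"
  edges :: "'a set set"
  sigma :: "'a set \<Rightarrow> int"

definition is_signed_graph :: "'a signed_graph \<Rightarrow> bool" where
  "is_signed_graph G \<longleftrightarrow> finite (verts G) \<and>
     (\<forall>e \<in> edges G. \<exists>x \<in> verts G. \<exists>y \<in> verts G. x \<noteq> y \<and> e = {x, y}) \<and>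
     (\<forall>e \<in> edges G. sigma G e \<in> {-1, 1})"

text \<open>A cycle is given by the list of its vertices in cyclic order, without repeating the first one.\<close>

definition is_cycle :: "'a signed_graph \<Rightarrow> 'a list \<Rightarrow> bool" where
  "is_cycle G c \<longleftrightarrow> 3 \<le> length c \<and> distinct c \<and> set c \<subseteq> verts G \<and>
     (\<forall>i < length c. {c ! i, c ! (Suc i mod length c)} \<in> edges G)"

definition cycle_sign :: "'a signed_graph \<Rightarrow> 'a list \<Rightarrow> int" where
  "cycle_sign G c = (\<Prod>i < length c. sigma G {c ! i, c ! (Suc i mod length c)})"

definition balanced :: "'a signed_graph \<Rightarrow> bool" where
  "balanced G \<longleftrightarrow> (\<forall>c. is_cycle G c \<longrightarrow> cycle_sign G c = 1)"

abbreviation unbalanced :: "'a signed_graph \<Rightarrow> bool" where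
  "unbalanced G \<equiv> \<not> balanced G"

definition switch :: "'a signed_graph \<Rightarrow> 'a set \<Rightarrow> 'a signed_graph" where
  "switch G U = G\<lparr>sigma := \<lambda>e.
     if \<exists>x \<in> U. \<exists>y \<in> verts G - U. e = {x, y} then - sigma G e else sigma G e\<rparr>"

definition isomorphic :: "'a signed_graph \<Rightarrow> 'b signed_graph \<Rightarrow> bool" where
  "isomorphic G H \<longleftrightarrow> (\<exists>f. bij_betw f (verts G) (verts H) \<and>
     (\<forall>x \<in> verts G. \<forall>y \<in> verts G.
        ({x, y} \<in> edges G \<longleftrightarrow> {f x, f y} \<in> edges H) \<and>
        ({x, y} \<in> edges G \<longrightarrow> sigma G {x, y} = sigma H {f x, f y})))"

definition switching_equivalent :: "'a signed_graph \<Rightarrow> 'b signed_graph \<Rightarrow> bool"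
    (infix "\<sim>\<^sub>s" 50) where
  "G \<sim>\<^sub>s H \<longleftrightarrow> (\<exists>U \<subseteq> verts G. isomorphic (switch G U) H)"

definition signed_subgraph :: "'a signed_graph \<Rightarrow> 'a signed_graph \<Rightarrow> bool" where
  "signed_subgraph H G \<longleftrightarrow> is_signed_graph H \<and> verts H \<subseteq> verts G \<and> edges H \<subseteq> edges G \<and>
     (\<forall>e \<in> edges H. sigma H e = sigma G e)"

definition unbalanced_K4s :: "'a signed_graph set" where
  "unbalanced_K4s = {H. is_signed_graph H \<and> card (verts H) = 4 \<and>
     edges H = {{x, y} | x y. x \<in> verts H \<and> y \<in> verts H \<and> x \<noteq> y} \<and> unbalanced H}"

text \<open>As \<^const>\<open>unbalanced_K4s\<close> is closed under isomorphism, it suffices to consider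
  members on the vertex type of \<open>G\<close> itself.\<close>

definition unbalanced_K4_free :: "'a signed_graph \<Rightarrow> bool" where
  "unbalanced_K4_free G \<longleftrightarrow> \<not> (\<exists>H \<in> unbalanced_K4s. signed_subgraph H G)"

text \<open>Matrices are indexed by \<open>{0..<n}\<close>, so the vertices are listed in some order; another
  order conjugates the matrix by a permutation and leaves the eigenvalues unchanged.
  The entries are taken complex because \<^const>\<open>spectral_radius\<close> is only defined for
  complex matrices; as the matrix is real symmetric, its complex eigenvalues are exactly
  its (real) eigenvalues.\<close>

definition vertex_list :: "'a signed_graph \<Rightarrow> 'a list" where
  "vertex_list G = (SOME xs. distinct xs \<and> set xs = verts G)"

definition adjacency_matrix :: "'a signed_graph \<Rightarrow> complex mat" where
  "adjacency_matrix G = (let xs = vertex_list G in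
     mat (length xs) (length xs) (\<lambda>(i, j).
       if {xs ! i, xs ! j} \<in> edges G then of_int (sigma G {xs ! i, xs ! j}) else 0))"

definition rho :: "'a signed_graph \<Rightarrow> real" where
  "rho G = spectral_radius (adjacency_matrix G)"

text \<open>\<open>G1_0 b\<close> is the graph \<open>G\<^sub>1(0, b)\<close>, with \<open>u = 0\<close>, \<open>v = 1\<close>, \<open>w = 2\<close> and
  \<open>B = {3..<b + 3}\<close>.\<close>

definition G1_0 :: "nat \<Rightarrow> nat signed_graph" where
  "G1_0 b = \<lparr>verts = {0, 1, 2} \<union> {3..<b + 3},
     edges = {{x, y} | x y. x < b + 3 \<and> y < b + 3 \<and> x \<noteq> y} - {{0, z} | z. z \<in> {3..<b + 3}},
     sigma = (\<lambda>e. if e = {0, 1} then -1 else 1)\<rparr>"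

end

theory Submission
  imports Defs "HOL-Analysis.Convex"
begin

text \<open>Switch so that an eigenvector \<open>y\<close> for an eigenvalue of modulus \<open>rho G\<close> becomes nonnegative.
  If the eigenvalue is negative, only the negative edges contribute; they contain no \<open>K\<^sub>4\<close>
  (its triangles would be negative), so Motzkin--Straus gives \<open>rho G \<le> 2 n / 3 < n - 2\<close>. Otherwise unbalance provides a negative edge
  \<open>uv\<close>, and \<open>(n - 2) (y \<bullet> y) - y \<bullet> A y\<close> is bounded below by a sum of squares, where the missing edges
  come from the other vertices being positively adjacent to at most one of \<open>u\<close>, \<open>v\<close>, or adjacent to at
  most two vertices of a negative triangle \<open>uvw\<close>. If the squares vanish, \<open>y\<close> is zero at one vertex
  and constant elsewhere, and the eigenvalue equations then determine the graph.\<close>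

section \<open>Quadratic forms on nonnegative weights and the Motzkin--Straus inequality\<close>

definition quadratic_form :: "('a \<Rightarrow> 'a \<Rightarrow> real) \<Rightarrow> 'a set \<Rightarrow> ('a \<Rightarrow> real) \<Rightarrow> real" where
  "quadratic_form b V y = (\<Sum>i\<in>V. \<Sum>j\<in>V. b i j * y i * y j)"

lemma quadratic_form_insert:
  assumes "finite V" "u \<notin> V" "\<And>i j. b i j = b j i" "\<And>i. b i i = 0"
  shows "quadratic_form b (insert u V) y
    = quadratic_form b V y + 2 * y u * (\<Sum>z\<in>V. b u z * y z)"
proof -
  have "(\<Sum>i\<in>V. b i u * y i * y u) = y u * (\<Sum>z\<in>V. b u z * y z)"
    "(\<Sum>j\<in>V. b u j * y u * y j) = y u * (\<Sum>z\<in>V. b u z * y z)"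
    by (auto simp: sum_distrib_left assms(3)[of _ u] intro!: sum.cong)
  then show ?thesis
    using assms(1,2,4) by (simp add: quadratic_form_def sum.distrib)
qed

lemma quadratic_form_eigenvector:
  assumes "\<forall>i\<in>V. (\<Sum>j\<in>V. b i j * y j) = k * y i"
  shows "quadratic_form b V y = k * (\<Sum>i\<in>V. (y i)\<^sup>2)"
proof -
  have "quadratic_form b V y = (\<Sum>i\<in>V. y i * (\<Sum>j\<in>V. b i j * y j))"
    by (simp add: quadratic_form_def sum_distrib_left mult_ac)
  also have "\<dots> = (\<Sum>i\<in>V. y i * (k * y i))"
    using assms by (intro sum.cong) auto
  finally show ?thesis
    by (simp add: sum_distrib_left power2_eq_square mult_ac)
qed

text \<open>Nonnegative weights allow every off-diagonal coefficient to be raised to 1; what results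
  is the form of the complete graph with all edges positive.\<close>

lemma quadratic_form_le_complete:
  assumes "finite V" "\<And>i. b i i = 0" "\<And>i j. b i j \<le> 1" "\<forall>i\<in>V. 0 \<le> y i"
  shows "quadratic_form b V y \<le> (\<Sum>i\<in>V. y i)\<^sup>2 - (\<Sum>i\<in>V. (y i)\<^sup>2)"
proof -
  have "b i j * y i * y j \<le> y i * y j - (if j = i then (y i)\<^sup>2 else 0)"
    if "i \<in> V" "j \<in> V" for i j
    using assms(2,3)[of i] assms(3)[of i j] assms(4) that
    by (auto simp: power2_eq_square mult.assoc intro!: mult_left_le_one_le mult_right_mono[of "b i j" 1, simplified])
  then have "quadratic_form b V y
      \<le> (\<Sum>i\<in>V. \<Sum>j\<in>V. y i * y j - (if j = i then (y i)\<^sup>2 else 0))"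
    unfolding quadratic_form_def by (intro sum_mono) auto
  also have "\<dots> = (\<Sum>i\<in>V. y i)\<^sup>2 - (\<Sum>i\<in>V. (y i)\<^sup>2)"
    using assms(1) by (simp add: sum_subtractf sum.delta power2_eq_square sum_product)
  finally show ?thesis .
qed

lemma sum_square_diff:
  fixes y :: "'a \<Rightarrow> real"
  shows "(\<Sum>z\<in>B. (y z - t)\<^sup>2) = (\<Sum>z\<in>B. (y z)\<^sup>2) - 2 * t * (\<Sum>z\<in>B. y z) + real (card B) * t\<^sup>2"
proof -
  have "(\<Sum>z\<in>B. (y z - t)\<^sup>2) = (\<Sum>z\<in>B. (y z)\<^sup>2 - 2 * t * y z + t\<^sup>2)"
    by (intro sum.cong) (auto simp: power2_diff)
  then show ?thesis
    by (simp add: sum.distrib sum_subtractf sum_distrib_left)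
qed

text \<open>Move the weight of one of two nonadjacent vertices to the other: the form is affine along
  this line, so one of the two directions does not decrease it.\<close>

lemma motzkin_straus_K4_free:
  fixes b :: "'a \<Rightarrow> 'a \<Rightarrow> real"
  assumes "finite V" "\<And>i j. b i j = b j i" "\<And>i. b i i = 0" "\<And>i j. b i j \<in> {0, 1}"
    and K4: "\<And>p q r s. \<lbrakk>p \<in> V; q \<in> V; r \<in> V; s \<in> V; b p q = 1; b p r = 1; b p s = 1; b q r = 1;
      b q s = 1; b r s = 1\<rbrakk> \<Longrightarrow> False"
    and "\<forall>i\<in>V. 0 \<le> y i"
  shows "3 * quadratic_form b V y \<le> 2 * (\<Sum>i\<in>V. y i)\<^sup>2"
  using assms(1) K4 assms(6)
proof (induction "card V" arbitrary: V y rule: less_induct)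
  case less
  show ?case
  proof (cases "\<exists>p\<in>V. \<exists>q\<in>V. p \<noteq> q \<and> b p q = 0")
    case True
    then obtain p q where pq: "p \<in> V" "q \<in> V" "p \<noteq> q" "b p q = 0" by blast
    \<comment> \<open>\<open>d z\<close> is half the partial derivative of the form at
      \<open>z\<close>; the pair is then named so that weight is better placed on
      \<open>p\<close>.\<close>
    define d where "d z = (\<Sum>j\<in>V. b z j * y j)" for z
    obtain p q where pq: "p \<in> V" "q \<in> V" "p \<noteq> q" "b p q = 0" "d q \<le> d p"
      using pq assms(2)[of p q] by (cases "d q \<le> d p") auto
    define W where "W = V - {p, q}"
    have W: "finite W" "p \<notin> W" "q \<notin> W" "V = insert q (insert p W)" "V - {q} = insert p W"
      using pq less.prems(1) by (auto simp: W_def)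
    define y' where "y' = y(p := y p + y q)"
    have y': "(\<Sum>z\<in>W. f z * y' z) = (\<Sum>z\<in>W. f z * y z)" "(\<Sum>z\<in>W. y' z) = (\<Sum>z\<in>W. y z)"
      "quadratic_form b W y' = quadratic_form b W y" for f
    proof -
      have "y' z = y z" if "z \<in> W" for z using that W(2) by (auto simp: y'_def)
      then show "(\<Sum>z\<in>W. f z * y' z) = (\<Sum>z\<in>W. f z * y z)" "(\<Sum>z\<in>W. y' z) = (\<Sum>z\<in>W. y z)"
        "quadratic_form b W y' = quadratic_form b W y"
        by (simp_all add: quadratic_form_def cong: sum.cong)
    qed
    \<comment> \<open>Nonadjacency keeps the weights of \<open>p\<close> and \<open>q\<close> out of
      \<open>d p\<close> and \<open>d q\<close>.\<close>
    have b: "b q p = 0" "b p q = 0" "b p p = 0" using pq assms(2)[of p q] assms(3) by auto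
    have d: "d p = (\<Sum>z\<in>W. b p z * y z)" "d q = (\<Sum>z\<in>W. b q z * y z)"
      using W pq(3) b assms(3) by (simp_all add: d_def)
    have "quadratic_form b V y = quadratic_form b W y + 2 * y p * d p + 2 * y q * d q"
      using W pq(3) assms(2,3) b by (simp add: quadratic_form_insert d)
    also have "\<dots> \<le> quadratic_form b W y + 2 * (y p + y q) * d p"
      using pq(2,5) less.prems(3) by (auto simp: distrib_right distrib_left intro!: mult_left_mono)
    also have "\<dots> = quadratic_form b (V - {q}) y'"
      unfolding W(5) using W pq(3) assms(2,3) by (simp add: quadratic_form_insert d y') (simp add: y'_def)
    finally have "3 * quadratic_form b V y \<le> 3 * quadratic_form b (V - {q}) y'" by simp
    also have "\<dots> \<le> 2 * (\<Sum>i\<in>V - {q}. y' i)\<^sup>2"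
    proof (rule less.hyps)
      show "card (V - {q}) < card V" using less.prems(1) pq(2) by (rule card_Diff1_less)
      show "\<forall>i\<in>V - {q}. 0 \<le> y' i" using less.prems(3) pq by (auto simp: y'_def)
    qed (use less.prems in auto)
    also have "(\<Sum>i\<in>V - {q}. y' i) = (\<Sum>i\<in>V. y i)"
      using W pq(3) by (simp add: y') (simp add: y'_def)
    finally show ?thesis .
  next
    case False
    then have adj: "b p q = 1" if "p \<in> V" "q \<in> V" "p \<noteq> q" for p q
      using that assms(4)[of p q] by auto
    \<comment> \<open>All pairs are adjacent now, so a fourth vertex would create the excluded
      \<open>K\<^sub>4\<close>.\<close>
    have card: "card V \<le> 3"
    proof (rule ccontr)
      assume "\<not> card V \<le> 3"
      then obtain K where K: "K \<subseteq> V" "card K = 4"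
        by (metis obtain_subset_with_card_n not_less_eq_eq numeral_3_eq_3 eval_nat_numeral(2) semiring_norm(26) semiring_norm(27))
      then obtain p q r s where "K = {p, q, r, s}" "distinct [p, q, r, s]"
        by (auto simp: card_Suc_eq numeral_eq_Suc)
      with K less.prems(2)[of p q r s] adj show False by auto
    qed
    have "quadratic_form b V y \<le> (\<Sum>i\<in>V. y i)\<^sup>2 - (\<Sum>i\<in>V. (y i)\<^sup>2)"
      using less.prems assms(3) assms(4) by (intro quadratic_form_le_complete) (auto, metis insertE order_refl singletonD zero_le_one)
    \<comment> \<open>Cauchy--Schwarz on at most three vertices: the sum of squares is at least a
      third of the squared total, which leaves two thirds.\<close>
    moreover have "(\<Sum>i\<in>V. y i)\<^sup>2 \<le> 3 * (\<Sum>i\<in>V. (y i)\<^sup>2)"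
    proof -
      have "(\<Sum>i\<in>V. y i)\<^sup>2 \<le> (\<Sum>i\<in>V. (y i)\<^sup>2) * card V"
        by (rule sum_squared_le_sum_of_squares)
      also have "\<dots> \<le> (\<Sum>i\<in>V. (y i)\<^sup>2) * 3"
        using card by (intro mult_left_mono sum_nonneg) auto
      finally show ?thesis by simp
    qed
    ultimately show ?thesis by simp
  qed
qed


section \<open>Signed matrices in which every \<open>K\<^sub>4\<close> is balanced\<close>

text \<open>For symmetric \<open>b\<close> with zero diagonal this is the signed adjacency matrix of
  the extremal graph, with \<open>c\<close>, \<open>p\<close>, \<open>q\<close> as its vertices u,
  v, w.\<close>

definition near_complete :: "'a set \<Rightarrow> ('a \<Rightarrow> 'a \<Rightarrow> real) \<Rightarrow> bool" where
  "near_complete V b \<longleftrightarrow> (\<exists>c\<in>V. \<exists>p\<in>V. \<exists>q\<in>V. b c p = -1 \<and> b c q = 1 \<and>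
    (\<forall>z\<in>V - {c, p, q}. b c z = 0) \<and> (\<forall>i\<in>V - {c}. \<forall>j\<in>V - {c}. i \<noteq> j \<longrightarrow> b i j = 1))"

text \<open>Real matrices take the place of graphs, so that switching is a mere change of signs.
  Assumption \<open>K4\<close> speaks of one triangle of a \<open>K\<^sub>4\<close>; permuting the
  four vertices gives the others.\<close>

locale K4_balanced =
  fixes V :: "'a set" and b :: "'a \<Rightarrow> 'a \<Rightarrow> real"
  assumes finite_V: "finite V"
    and sym: "b i j = b j i"
    and irrefl: "b i i = 0"
    and entries: "b i j \<in> {-1, 0, 1}"
    and K4: "\<lbrakk>p \<in> V; q \<in> V; r \<in> V; s \<in> V; b p q \<noteq> 0; b p r \<noteq> 0; b p s \<noteq> 0; b q r \<noteq> 0;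
      b q s \<noteq> 0; b r s \<noteq> 0\<rbrakk> \<Longrightarrow> b p q * b q r * b p r = 1"
begin

lemma b_le_1: "b i j \<le> 1"
  using entries[of i j] by auto

lemma b_mult_le: "0 \<le> c \<Longrightarrow> b i j * c \<le> c"
  using mult_right_mono[OF b_le_1[of i j]] by simp

text \<open>Each sign \<open>s i\<close> enters the product around a triangle twice and cancels. So
  an eigenvector can be made nonnegative without leaving the locale.\<close>

lemma switching:
  assumes "\<And>i. s i \<in> {-1, 1 :: real}"
  shows "K4_balanced V (\<lambda>i j. s i * s j * b i j)"
proof
  show "finite V" by (rule finite_V)
  show "s i * s j * b i j = s j * s i * b j i" for i j by (simp add: sym[of i j])
  show "s i * s i * b i i = 0" for i by (simp add: irrefl)
  show "s i * s j * b i j \<in> {-1, 0, 1}" for i j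
    using assms[of i] assms[of j] entries[of i j] by auto
  fix p q r t
  assume "p \<in> V" "q \<in> V" "r \<in> V" "t \<in> V" "s p * s q * b p q \<noteq> 0" "s p * s r * b p r \<noteq> 0"
    "s p * s t * b p t \<noteq> 0" "s q * s r * b q r \<noteq> 0" "s q * s t * b q t \<noteq> 0" "s r * s t * b r t \<noteq> 0"
  then have "b p q * b q r * b p r = 1" by (intro K4[of p q r t]) auto
  then show "s p * s q * b p q * (s q * s r * b q r) * (s p * s r * b p r) = 1"
    using assms[of p] assms[of q] assms[of r] by auto
qed

text \<open>Meant for negative eigenvalues. Only negative entries can increase the negated form;
  their indicator \<open>c\<close> is bounded by Motzkin--Straus and then by
  Cauchy--Schwarz.\<close>

lemma negated_form_bound:
  assumes "\<forall>i\<in>V. 0 \<le> y i"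
  shows "- 3 * quadratic_form b V y \<le> 2 * real (card V) * (\<Sum>i\<in>V. (y i)\<^sup>2)"
proof -
  define c where "c i j = (if b i j = -1 then 1 else 0 :: real)" for i j
  have "- (b i j * y i * y j) \<le> c i j * y i * y j" if "i \<in> V" "j \<in> V" for i j
    using assms that entries[of i j] by (auto simp: c_def)
  then have "- quadratic_form b V y \<le> quadratic_form c V y"
    unfolding quadratic_form_def sum_negf[symmetric] by (intro sum_mono) auto
  moreover have "3 * quadratic_form c V y \<le> 2 * (\<Sum>i\<in>V. y i)\<^sup>2"
  proof (rule motzkin_straus_K4_free)
    fix p q r s
    assume "p \<in> V" "q \<in> V" "r \<in> V" "s \<in> V" "c p q = 1" "c p r = 1" "c p s = 1" "c q r = 1"
      "c q s = 1" "c r s = 1"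
    \<comment> \<open>A triangle of three negative entries has product -1.\<close>
    then show False using K4[of p q r s] by (auto simp: c_def split: if_splits)
  qed (use finite_V assms irrefl in \<open>auto simp: c_def sym\<close>)
  moreover have "(\<Sum>i\<in>V. y i)\<^sup>2 \<le> real (card V) * (\<Sum>i\<in>V. (y i)\<^sup>2)"
    using sum_squared_le_sum_of_squares[of y V] by (simp add: mult.commute)
  ultimately show ?thesis by linarith
qed

text \<open>\<open>u\<close>, \<open>v\<close>, \<open>w\<close> span a negative triangle, so every other vertex is adjacent to at most two of
  them and its weight is coupled to at most \<open>t\<close>, the largest pair sum.\<close>

lemma form_bound_triangle:
  assumes y: "\<forall>i\<in>V. 0 \<le> y i" and V: "u \<in> V" "v \<in> V" "w \<in> V" "3 < card V"
    and uvw: "b u v = -1" "b u w = 1" "b v w = 1"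
  defines "k \<equiv> real (card V) - 2"
  shows "quadratic_form b V y \<le> k * (\<Sum>i\<in>V. (y i)\<^sup>2) \<and>
    (quadratic_form b V y = k * (\<Sum>i\<in>V. (y i)\<^sup>2)
      \<longrightarrow> (\<exists>c\<in>V. \<exists>a. y c = 0 \<and> (\<forall>i\<in>V - {c}. y i = a)))"
proof -
  define B where "B = V - {u, v, w}"
  have distinct: "u \<noteq> v" "u \<noteq> w" "v \<noteq> w" using uvw irrefl by auto
  have VB: "V = insert u (insert v (insert w B))" "u \<notin> insert v (insert w B)" "v \<notin> insert w B"
    "w \<notin> B" and B: "finite B"
    using V distinct finite_V by (auto simp: B_def)
  define m where "m = real (card B)"
  have m: "k = m + 1" and "m > 0"
  proof -
    have "card V = card B + 3" unfolding VB(1) using VB(2-) B by simp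
    then show "k = m + 1" "m > 0" using V(4) by (simp_all add: m_def k_def)
  qed
  define R S where "R = (\<Sum>i\<in>B. (y i)\<^sup>2)" and "S = (\<Sum>i\<in>B. y i)"
  have yB: "\<forall>z\<in>B. 0 \<le> y z" using y by (auto simp: B_def)
  have formB: "quadratic_form b B y \<le> S\<^sup>2 - R"
    unfolding R_def S_def using B yB irrefl b_le_1 by (intro quadratic_form_le_complete)
  have S: "S\<^sup>2 \<le> m * R"
    unfolding R_def S_def m_def using sum_squared_le_sum_of_squares[of y B] by (simp add: mult.commute)
  \<comment> \<open>\<open>p\<close> and \<open>q\<close> are the two heaviest among
    \<open>u\<close>, \<open>v\<close>, \<open>w\<close>, and \<open>r\<close> is the
    lightest.\<close>
  obtain t p q r where t: "y u + y v \<le> t" "y u + y w \<le> t" "y v + y w \<le> t" "t = y p + y q"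
    and pqr: "{p, q, r} = {u, v, w}" "distinct [p, q, r]"
  proof -
    consider "y w \<le> y u" "y w \<le> y v" | "y v \<le> y u" "y v \<le> y w" | "y u \<le> y v" "y u \<le> y w"
      by linarith
    then show ?thesis
    proof cases
      case 1 then show ?thesis using distinct by (intro that[of "y u + y v" u v w]) auto
    next
      case 2 then show ?thesis using distinct by (intro that[of "y u + y w" u w v]) auto
    next
      case 3 then show ?thesis using distinct by (intro that[of "y v + y w" v w u]) auto
    qed
  qed
  have "b u z * y u + b v z * y v + b w z * y w \<le> t" if z: "z \<in> B" for z
  proof -
    have "b u z = 0 \<or> b v z = 0 \<or> b w z = 0"
    proof (rule ccontr)
      assume "\<not> ?thesis"
      then have "b u v * b v w * b u w = 1"
        using V z uvw by (intro K4[of u v w z]) (auto simp: B_def)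
      then show False using uvw by simp
    qed
    then show ?thesis
      using b_mult_le[of "y u" u z] b_mult_le[of "y v" v z] b_mult_le[of "y w" w z] y V t by auto
  qed
  then have "(\<Sum>z\<in>B. y z * (b u z * y u + b v z * y v + b w z * y w)) \<le> (\<Sum>z\<in>B. y z * t)"
    using yB by (intro sum_mono mult_left_mono) auto
  then have cross: "(\<Sum>z\<in>B. y z * (b u z * y u + b v z * y v + b w z * y w)) \<le> t * S"
    by (simp add: S_def sum_distrib_left mult.commute)
  have "quadratic_form b V y = quadratic_form b B y
      + 2 * (\<Sum>z\<in>B. y z * (b u z * y u + b v z * y v + b w z * y w))
      + 2 * (y u * y w + y v * y w - y u * y v)"
    unfolding VB(1) using VB(2-) B uvw sym irrefl
    by (simp add: quadratic_form_insert sum.distrib sum_distrib_left algebra_simps)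
  then have form: "quadratic_form b V y \<le> S\<^sup>2 - R + 2 * t * S + 2 * (y u * y w + y v * y w - y u * y v)"
    using formB cross by linarith
  have squares: "(\<Sum>i\<in>V. (y i)\<^sup>2) = R + (y u)\<^sup>2 + (y v)\<^sup>2 + (y w)\<^sup>2"
    unfolding VB(1) using VB(2-) B by (simp add: R_def)
  have dev: "(\<Sum>z\<in>B. (y z - t / 2)\<^sup>2) = R - t * S + m * (t / 2)\<^sup>2"
    unfolding sum_square_diff R_def S_def m_def by simp
  have squares_pqr: "(y p)\<^sup>2 + (y q)\<^sup>2 + (y r)\<^sup>2 = (y u)\<^sup>2 + (y v)\<^sup>2 + (y w)\<^sup>2"
  proof -
    have "(\<Sum>i\<in>{p, q, r}. (y i)\<^sup>2) = (\<Sum>i\<in>{u, v, w}. (y i)\<^sup>2)" by (simp only: pqr(1))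
    then show ?thesis using pqr(2) distinct by simp
  qed
  \<comment> \<open>Completing squares: the weights on \<open>B\<close> are compared with
    \<open>t / 2\<close>, which leaves half the square of \<open>y p - y q\<close>, and the terms
    inside the triangle combine to the square of \<open>y u + y v - y w\<close>.\<close>
  have "m * (R + ((y p)\<^sup>2 + (y q)\<^sup>2 + (y r)\<^sup>2)) + R + ((y u)\<^sup>2 + (y v)\<^sup>2 + (y w)\<^sup>2)
      - (S\<^sup>2 - R + 2 * t * S + 2 * (y u * y w + y v * y w - y u * y v))
    = (m * R - S\<^sup>2) + 2 * (R - t * S + m * (t / 2)\<^sup>2) + m * ((y p - y q)\<^sup>2 / 2 + (y r)\<^sup>2)
      + (y u + y v - y w)\<^sup>2"
    unfolding t(4) by (simp add: power2_eq_square field_simps)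
  then have key: "k * (\<Sum>i\<in>V. (y i)\<^sup>2) - (S\<^sup>2 - R + 2 * t * S + 2 * (y u * y w + y v * y w - y u * y v))
    = (m * R - S\<^sup>2) + 2 * (\<Sum>z\<in>B. (y z - t / 2)\<^sup>2) + m * ((y p - y q)\<^sup>2 / 2 + (y r)\<^sup>2)
      + (y u + y v - y w)\<^sup>2"
    unfolding squares_pqr dev m squares by (simp add: algebra_simps)
  have nonneg: "0 \<le> (\<Sum>z\<in>B. (y z - t / 2)\<^sup>2)" "0 \<le> m * ((y p - y q)\<^sup>2 / 2 + (y r)\<^sup>2)"
    using \<open>m > 0\<close> by (auto intro!: sum_nonneg)
  have "\<exists>c\<in>V. \<exists>a. y c = 0 \<and> (\<forall>i\<in>V - {c}. y i = a)"
    if "quadratic_form b V y = k * (\<Sum>i\<in>V. (y i)\<^sup>2)"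
  proof -
    \<comment> \<open>Equality makes every square vanish; as \<open>m > 0\<close>, the weights at
      \<open>p\<close>, \<open>q\<close> and on \<open>B\<close> all equal \<open>t / 2\<close>, and
      \<open>y r = 0\<close>.\<close>
    have *: "(\<Sum>z\<in>B. (y z - t / 2)\<^sup>2) = 0" "m * ((y p - y q)\<^sup>2 / 2 + (y r)\<^sup>2) = 0"
      using that form key S nonneg zero_le_power2[of "y u + y v - y w"] by linarith+
    then have "\<forall>z\<in>B. y z = t / 2" using B by (simp add: sum_nonneg_eq_0_iff)
    moreover from *(2) have "y p = y q" "y r = 0"
      using \<open>m > 0\<close> by (auto simp: add_nonneg_eq_0_iff)
    moreover have "V = {p, q, r} \<union> B" unfolding pqr(1) VB(1) by auto
    ultimately show ?thesis using t(4) by (intro bexI[of _ r] exI[of _ "y p"]) auto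
  qed
  then show ?thesis
    using form key S nonneg zero_le_power2[of "y u + y v - y w"] by (intro conjI impI) linarith+
qed

text \<open>Any other vertex has a positive entry to at most one of \<open>u\<close> and
  \<open>v\<close>, so its weight is coupled to at most the heavier of the two. The squares are
  completed around that weight \<open>y p\<close>.\<close>

lemma form_bound_no_triangle:
  assumes y: "\<forall>i\<in>V. 0 \<le> y i" and V: "u \<in> V" "v \<in> V" "2 < card V" and uv: "b u v = -1"
    and no_common: "\<forall>w\<in>V. b u w \<noteq> 1 \<or> b v w \<noteq> 1"
  defines "k \<equiv> real (card V) - 2"
  shows "quadratic_form b V y \<le> k * (\<Sum>i\<in>V. (y i)\<^sup>2) \<and>
    (quadratic_form b V y = k * (\<Sum>i\<in>V. (y i)\<^sup>2)
      \<longrightarrow> (\<exists>c\<in>V. \<exists>a. y c = 0 \<and> (\<forall>i\<in>V - {c}. y i = a)))"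
proof -
  define B where "B = V - {u, v}"
  have "u \<noteq> v" using uv irrefl by auto
  then have VB: "V = insert u (insert v B)" "u \<notin> insert v B" "v \<notin> B" and B: "finite B"
    using V finite_V by (auto simp: B_def)
  define m where "m = real (card B)"
  have m: "k = m" and "m > 0"
  proof -
    have "card V = card B + 2" unfolding VB(1) using VB(2-) B by simp
    then show "k = m" "m > 0" using V(3) by (simp_all add: m_def k_def)
  qed
  define R S where "R = (\<Sum>i\<in>B. (y i)\<^sup>2)" and "S = (\<Sum>i\<in>B. y i)"
  have yB: "\<forall>z\<in>B. 0 \<le> y z" using y by (auto simp: B_def)
  have formB: "quadratic_form b B y \<le> S\<^sup>2 - R"
    unfolding R_def S_def using B yB irrefl b_le_1 by (intro quadratic_form_le_complete)
  have S: "S\<^sup>2 \<le> m * R"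
    unfolding R_def S_def m_def using sum_squared_le_sum_of_squares[of y B] by (simp add: mult.commute)
  obtain p r where pr: "{p, r} = {u, v}" "y r \<le> y p"
    by (metis insert_commute linear)
  then have le: "y u \<le> y p" "y v \<le> y p" by (auto simp: doubleton_eq_iff)
  have "b u z * y u + b v z * y v \<le> y p" if z: "z \<in> B" for z
  proof -
    have "b u z \<le> 0 \<or> b v z \<le> 0"
      using no_common z entries[of u z] entries[of v z] by (fastforce simp: B_def)
    then show ?thesis
      using b_mult_le[of "y u" u z] b_mult_le[of "y v" v z] y V le
        mult_nonpos_nonneg[of "b u z" "y u"] mult_nonpos_nonneg[of "b v z" "y v"] by auto
  qed
  then have "(\<Sum>z\<in>B. y z * (b u z * y u + b v z * y v)) \<le> (\<Sum>z\<in>B. y z * y p)"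
    using yB by (intro sum_mono mult_left_mono) auto
  then have cross: "(\<Sum>z\<in>B. y z * (b u z * y u + b v z * y v)) \<le> y p * S"
    by (simp add: S_def sum_distrib_left mult.commute)
  have "quadratic_form b V y = quadratic_form b B y
      + 2 * (\<Sum>z\<in>B. y z * (b u z * y u + b v z * y v)) - 2 * (y u * y v)"
    unfolding VB(1) using VB(2-) B uv sym irrefl
    by (simp add: quadratic_form_insert sum.distrib sum_distrib_left algebra_simps)
  moreover have "0 \<le> y u * y v" using y V by simp
  ultimately have form: "quadratic_form b V y \<le> S\<^sup>2 - R + 2 * y p * S"
    using formB cross by linarith
  have squares: "(\<Sum>i\<in>V. (y i)\<^sup>2) = R + (y p)\<^sup>2 + (y r)\<^sup>2"
    unfolding VB(1) using VB(2-) B pr by (auto simp: R_def doubleton_eq_iff)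
  have dev: "(\<Sum>z\<in>B. (y z - y p)\<^sup>2) = R - 2 * y p * S + m * (y p)\<^sup>2"
    unfolding sum_square_diff R_def S_def m_def by simp
  have key: "k * (\<Sum>i\<in>V. (y i)\<^sup>2) - (S\<^sup>2 - R + 2 * y p * S)
    = (m * R - S\<^sup>2) + (\<Sum>z\<in>B. (y z - y p)\<^sup>2) + m * (y r)\<^sup>2"
    unfolding dev m squares by (simp add: algebra_simps)
  have nonneg: "0 \<le> (\<Sum>z\<in>B. (y z - y p)\<^sup>2)" "0 \<le> m * (y r)\<^sup>2"
    using \<open>m > 0\<close> by (auto intro!: sum_nonneg)
  have "\<exists>c\<in>V. \<exists>a. y c = 0 \<and> (\<forall>i\<in>V - {c}. y i = a)"
    if "quadratic_form b V y = k * (\<Sum>i\<in>V. (y i)\<^sup>2)"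
  proof -
    have *: "(\<Sum>z\<in>B. (y z - y p)\<^sup>2) = 0" "m * (y r)\<^sup>2 = 0"
      using that form key S nonneg by linarith+
    then have "\<forall>z\<in>B. y z = y p" using B by (simp add: sum_nonneg_eq_0_iff)
    moreover have "y r = 0" using *(2) \<open>m > 0\<close> by simp
    moreover have "V = {p, r} \<union> B" unfolding pr(1) VB(1) by auto
    ultimately show ?thesis by (intro bexI[of _ r] exI[of _ "y p"]) auto
  qed
  then show ?thesis
    using form key S nonneg by (intro conjI impI) linarith+
qed

text \<open>A common positive neighbour of \<open>u\<close> and \<open>v\<close> decides which of
  the two estimates applies. The shape of \<open>y\<close> under equality later turns eigenvalue
  equations into row sums.\<close>

lemma form_bound:
  assumes y: "\<forall>i\<in>V. 0 \<le> y i" and "u \<in> V" "v \<in> V" "b u v = -1" "3 < card V"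
  defines "k \<equiv> real (card V) - 2"
  shows "quadratic_form b V y \<le> k * (\<Sum>i\<in>V. (y i)\<^sup>2)"
    and "quadratic_form b V y = k * (\<Sum>i\<in>V. (y i)\<^sup>2)
      \<Longrightarrow> \<exists>c\<in>V. \<exists>a. y c = 0 \<and> (\<forall>i\<in>V - {c}. y i = a)"
proof -
  have "quadratic_form b V y \<le> k * (\<Sum>i\<in>V. (y i)\<^sup>2) \<and>
    (quadratic_form b V y = k * (\<Sum>i\<in>V. (y i)\<^sup>2)
      \<longrightarrow> (\<exists>c\<in>V. \<exists>a. y c = 0 \<and> (\<forall>i\<in>V - {c}. y i = a)))"
  proof (cases "\<exists>w\<in>V. b u w = 1 \<and> b v w = 1")
    case True
    then obtain w where "w \<in> V" "b u w = 1" "b v w = 1" by blast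
    with assms form_bound_triangle[of y u v w] show ?thesis by simp
  next
    case False
    with assms form_bound_no_triangle[of y u v] show ?thesis by fastforce
  qed
  then show "quadratic_form b V y \<le> k * (\<Sum>i\<in>V. (y i)\<^sup>2)"
    and "quadratic_form b V y = k * (\<Sum>i\<in>V. (y i)\<^sup>2)
      \<Longrightarrow> \<exists>c\<in>V. \<exists>a. y c = 0 \<and> (\<forall>i\<in>V - {c}. y i = a)"
    by blast+
qed

text \<open>Equality in the form bound makes \<open>y\<close> zero at \<open>c\<close> and constant
  elsewhere. Dividing by the constant leaves prescribed row sums, which entries of at most 1 can
  meet in only one way outside \<open>c\<close>.\<close>

lemma extremal_structure:
  assumes y: "\<forall>i\<in>V. 0 \<le> y i" "\<exists>i\<in>V. y i \<noteq> 0"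
    and eigen: "\<forall>i\<in>V. (\<Sum>j\<in>V. b i j * y j) = (real (card V) - 2) * y i"
    and neg: "u \<in> V" "v \<in> V" "b u v = -1" and card: "3 < card V"
  shows "near_complete V b"
proof -
  have "quadratic_form b V y = (real (card V) - 2) * (\<Sum>i\<in>V. (y i)\<^sup>2)"
    by (rule quadratic_form_eigenvector[OF eigen])
  then obtain c a where c: "c \<in> V" "y c = 0" and a: "\<forall>i\<in>V - {c}. y i = a"
    using form_bound(2)[OF y(1) neg card] by blast
  then have "a \<noteq> 0" using y(2) by (metis DiffI singletonD)
  have row: "(\<Sum>j\<in>V - {c}. b i j) = (if i = c then 0 else real (card V) - 2)" if "i \<in> V" for i
  proof -
    have "(\<Sum>j\<in>V. b i j * y j) = (\<Sum>j\<in>V - {c}. b i j * a)"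
      using c a finite_V by (simp add: sum.remove)
    then have "(\<Sum>j\<in>V - {c}. b i j) * a = (real (card V) - 2) * y i"
      using eigen that by (simp add: sum_distrib_right)
    then show ?thesis using \<open>a \<noteq> 0\<close> c a that by (auto split: if_splits)
  qed
  have complete: "b i j = 1" if ij: "i \<in> V - {c}" "j \<in> V - {c}" "i \<noteq> j" for i j
  proof -
    \<comment> \<open>The row sum equals the number of its terms, each of which is at most
      1.\<close>
    have "(\<Sum>j\<in>V - {c} - {i}. 1 - b i j) = 0"
    proof -
      have "(\<Sum>j\<in>V - {c} - {i}. b i j) = real (card V) - 2"
        using row[of i] ij finite_V irrefl by (simp add: sum.remove[of "V - {c}" i])
      moreover have "real (card (V - {c} - {i})) = real (card V) - 2"
        using ij c finite_V card by (simp add: card_Diff_singleton)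
      ultimately show ?thesis by (simp add: sum_subtractf)
    qed
    then have "\<forall>j\<in>V - {c} - {i}. 1 - b i j = 0"
      using finite_V b_le_1 by (subst (asm) sum_nonneg_eq_0_iff) auto
    then show ?thesis using ij by auto
  qed
  \<comment> \<open>Away from \<open>c\<close> all entries are positive, so the negative edge
    \<open>u v\<close> meets \<open>c\<close>.\<close>
  obtain p where p: "p \<in> V" "b c p = -1"
  proof (cases "u = c")
    case False
    then have "v = c" using neg complete[of u v] irrefl[of u] by force
    then show ?thesis using neg sym[of u v] by (intro that[of u]) auto
  qed (use neg that in blast)
  \<comment> \<open>Row \<open>c\<close> sums to zero, so its entry -1 has to be compensated by a
    positive one.\<close>
  have "p \<noteq> c" using p irrefl by auto
  obtain q where q: "q \<in> V" "b c q = 1"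
  proof (rule ccontr)
    assume "\<not> thesis"
    with that have no: "b c z \<noteq> 1" if "z \<in> V" for z using \<open>z \<in> V\<close> by blast
    have "(\<Sum>j\<in>V - {c}. b c j) = b c p + (\<Sum>j\<in>V - {c} - {p}. b c j)"
      using finite_V p \<open>p \<noteq> c\<close> by (simp add: sum.remove)
    moreover have "(\<Sum>j\<in>V - {c} - {p}. b c j) \<le> 0"
    proof (rule sum_nonpos)
      fix j assume "j \<in> V - {c} - {p}"
      then show "b c j \<le> 0" using no[of j] entries[of c j] by auto
    qed
    ultimately show False using row[OF c(1)] p by simp
  qed
  have "q \<noteq> c" "p \<noteq> q" using p q irrefl by auto
  \<comment> \<open>A third neighbour \<open>z\<close> of \<open>c\<close> would complete a
    \<open>K\<^sub>4\<close> containing the negative triangle \<open>c p q\<close>.\<close>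
  have "b c z = 0" if z: "z \<in> V - {c, p, q}" for z
  proof (rule ccontr)
    assume "b c z \<noteq> 0"
    then have "b c p * b p q * b c q = 1"
      using K4[of c p q z] complete[of p q] complete[of p z] complete[of q z] c p q z
        \<open>p \<noteq> q\<close> \<open>p \<noteq> c\<close> \<open>q \<noteq> c\<close> by fastforce
    then show False using p q complete[of p q] \<open>p \<noteq> q\<close> \<open>p \<noteq> c\<close> \<open>q \<noteq> c\<close> by simp
  qed
  then show ?thesis unfolding near_complete_def using c p q complete by blast
qed

end


section \<open>From signed graphs to real matrices\<close>

text \<open>Real entries indexed by vertices keep the estimates free of the vertex order and of
  complex numbers.\<close>

definition signed_adj :: "'a signed_graph \<Rightarrow> 'a \<Rightarrow> 'a \<Rightarrow> real" where
  "signed_adj G x y = (if {x, y} \<in> edges G then real_of_int (sigma G {x, y}) else 0)"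

lemma signed_adj_sym: "signed_adj G x y = signed_adj G y x"
  by (simp add: signed_adj_def insert_commute)

lemma edge_endpoints:
  assumes "is_signed_graph G" "{x, y} \<in> edges G"
  shows "x \<in> verts G" "y \<in> verts G" "x \<noteq> y"
  using assms unfolding is_signed_graph_def by (auto simp: doubleton_eq_iff)

lemma sigma_edge:
  assumes "is_signed_graph G" "{x, y} \<in> edges G"
  shows "sigma G {x, y} = -1 \<or> sigma G {x, y} = 1"
  using assms unfolding is_signed_graph_def by auto

lemma signed_adj_nonzero_iff:
  assumes "is_signed_graph G"
  shows "signed_adj G x y \<noteq> 0 \<longleftrightarrow> {x, y} \<in> edges G"
  using sigma_edge[OF assms, of x y] by (auto simp: signed_adj_def)

text \<open>Four pairwise adjacent vertices span a complete signed subgraph \<open>H\<close>, which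
  the hypothesis makes balanced; the triangle \<open>p q r\<close> is a cycle of it.\<close>

lemma K4_balanced_signed_adj:
  assumes G: "is_signed_graph G" and free: "unbalanced_K4_free G"
  shows "K4_balanced (verts G) (signed_adj G)"
proof
  show "finite (verts G)" using G by (simp add: is_signed_graph_def)
  show "signed_adj G i j = signed_adj G j i" for i j by (rule signed_adj_sym)
  show "signed_adj G i i = 0" for i using edge_endpoints(3)[OF G, of i i] by (auto simp: signed_adj_def)
  show "signed_adj G i j \<in> {-1, 0, 1}" for i j using sigma_edge[OF G, of i j] by (auto simp: signed_adj_def)
  fix p q r s
  assume V: "p \<in> verts G" "q \<in> verts G" "r \<in> verts G" "s \<in> verts G"
    and "signed_adj G p q \<noteq> 0" "signed_adj G p r \<noteq> 0" "signed_adj G p s \<noteq> 0"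
      "signed_adj G q r \<noteq> 0" "signed_adj G q s \<noteq> 0" "signed_adj G r s \<noteq> 0"
  then have edges: "{p, q} \<in> edges G" "{p, r} \<in> edges G" "{p, s} \<in> edges G"
      "{q, r} \<in> edges G" "{q, s} \<in> edges G" "{r, s} \<in> edges G"
    by (simp_all add: signed_adj_nonzero_iff[OF G])
  then have distinct: "p \<noteq> q" "p \<noteq> r" "p \<noteq> s" "q \<noteq> r" "q \<noteq> s" "r \<noteq> s"
    using edge_endpoints(3)[OF G] by blast+
  define K where "K = {p, q, r, s}"
  define H where "H = \<lparr>verts = K, edges = {{x, y} | x y. x \<in> K \<and> y \<in> K \<and> x \<noteq> y}, sigma = sigma G\<rparr>"
  have sub: "edges H \<subseteq> edges G"
    using edges by (auto simp: H_def K_def insert_commute)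
  have "sigma G e \<in> {-1, 1}" if "e \<in> edges H" for e
    using that sub G by (auto simp: is_signed_graph_def)
  moreover have "\<exists>x\<in>verts H. \<exists>y\<in>verts H. x \<noteq> y \<and> e = {x, y}" if "e \<in> edges H" for e
    using that unfolding H_def by force
  moreover have "finite (verts H)" by (simp add: H_def K_def)
  ultimately have H: "is_signed_graph H"
    by (simp add: is_signed_graph_def H_def)
  then have "signed_subgraph H G"
    using sub V by (auto simp: signed_subgraph_def H_def K_def)
  with free have "H \<notin> unbalanced_K4s" by (auto simp: unbalanced_K4_free_def)
  moreover have "card (verts H) = 4" using distinct by (simp add: H_def K_def)
  ultimately have "balanced H" using H by (simp add: unbalanced_K4s_def) (simp add: H_def)
  moreover have "is_cycle H [p, q, r]"
  proof -
    have "{x, y} \<in> edges H" if "x \<in> K" "y \<in> K" "x \<noteq> y" for x y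
      using that unfolding H_def by auto
    moreover have "p \<in> K" "q \<in> K" "r \<in> K" "verts H = K" by (simp_all add: K_def H_def)
    ultimately show ?thesis
      unfolding is_cycle_def using distinct by (auto simp: less_Suc_eq)
  qed
  ultimately have "cycle_sign H [p, q, r] = 1" by (simp add: balanced_def)
  then have "sigma G {p, q} * sigma G {q, r} * sigma G {p, r} = 1"
    by (simp add: cycle_sign_def H_def lessThan_Suc insert_commute mult_ac)
  then show "signed_adj G p q * signed_adj G q r * signed_adj G p r = 1"
    using edges by (simp add: signed_adj_def flip: of_int_mult)
qed

text \<open>If no edge were negative after switching, \<open>sigma\<close> would be a coboundary, whose product
  around any cycle telescopes to 1.\<close>

lemma unbalanced_negative_edge:
  fixes s :: "'a \<Rightarrow> real"
  assumes G: "is_signed_graph G" and unb: "unbalanced G" and s: "\<And>i. s i \<in> {-1, 1}"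
  shows "\<exists>u\<in>verts G. \<exists>v\<in>verts G. s u * s v * signed_adj G u v = -1"
proof (rule ccontr)
  assume none: "\<not> ?thesis"
  \<comment> \<open>All factors are 1 or -1, so excluding the product -1 forces \<open>sigma\<close>
    to be the product of the signs at the two ends.\<close>
  have edge: "real_of_int (sigma G {u, v}) = s u * s v" if uv: "{u, v} \<in> edges G" for u v
  proof -
    have "s u * s v * signed_adj G u v \<noteq> -1"
      using none edge_endpoints[OF G uv] by blast
    then show ?thesis
      using uv s[of u] s[of v] sigma_edge[OF G uv] by (auto simp: signed_adj_def)
  qed
  have "cycle_sign G c = 1" if c: "is_cycle G c" for c
  proof -
    define l where "l = length c"
    have "l > 0" using c by (auto simp: is_cycle_def l_def)
    \<comment> \<open>One step along the cycle permutes the indices: 0 is reached from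
      \<open>l - 1\<close>, any other \<open>i\<close> from \<open>i - 1\<close>. So both ends of
      the edges run over the same signs.\<close>
    have "(\<lambda>i. Suc i mod l) ` {..<l} = {..<l}"
    proof (intro equalityI subsetI)
      fix i assume "i \<in> {..<l}"
      then show "i \<in> (\<lambda>i. Suc i mod l) ` {..<l}"
        by (cases i) (auto intro: image_eqI[of _ _ "l - 1"] image_eqI[of _ _ "i - 1"])
    qed (use \<open>l > 0\<close> in auto)
    then have "bij_betw (\<lambda>i. Suc i mod l) {..<l} {..<l}"
      by (simp add: bij_betw_def eq_card_imp_inj_on)
    then have shift: "(\<Prod>i<l. s (c ! (Suc i mod l))) = (\<Prod>i<l. s (c ! i))"
      by (rule prod.reindex_bij_betw)
    have "real_of_int (cycle_sign G c) = (\<Prod>i<l. s (c ! i) * s (c ! (Suc i mod l)))"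
      using c by (auto simp: cycle_sign_def is_cycle_def l_def edge intro!: prod.cong)
    also have "\<dots> = (\<Prod>i<l. s (c ! i) * s (c ! i))"
      by (simp only: prod.distrib shift)
    also have "\<dots> = 1"
    proof -
      have "s i * s i = 1" for i using s[of i] by auto
      then show ?thesis by simp
    qed
    finally show ?thesis by simp
  qed
  then show False using unb by (simp add: balanced_def)
qed

section \<open>Switching, isomorphism and the extremal graph\<close>

definition switch_sign :: "'a set \<Rightarrow> 'a \<Rightarrow> real" where
  "switch_sign U x = (if x \<in> U then -1 else 1)"

lemma switch_sign_values: "switch_sign U x \<in> {-1, 1}"
  by (simp add: switch_sign_def)

text \<open>An edge changes sign exactly when one of its ends lies in \<open>U\<close> and the other
  does not; this is conjugation by a diagonal sign matrix.\<close>

lemma signed_adj_switch: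
  assumes "x \<in> verts G" "y \<in> verts G"
  shows "signed_adj (switch G U) x y = switch_sign U x * switch_sign U y * signed_adj G x y"
proof -
  have "(\<exists>a\<in>U. \<exists>b\<in>verts G - U. {x, y} = {a, b}) \<longleftrightarrow> (x \<in> U) \<noteq> (y \<in> U)"
    using assms by (auto simp: doubleton_eq_iff)
  then show ?thesis
    by (auto simp: signed_adj_def switch_def switch_sign_def)
qed

lemma is_signed_graph_switch: "is_signed_graph G \<Longrightarrow> is_signed_graph (switch G U)"
  by (auto simp: is_signed_graph_def switch_def)

text \<open>Edge signs are nonzero, so a single entry records both adjacency and sign.\<close>

lemma isomorphic_iff_signed_adj:
  assumes "is_signed_graph G" "is_signed_graph H"
  shows "isomorphic G H \<longleftrightarrow> (\<exists>f. bij_betw f (verts G) (verts H) \<and>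
    (\<forall>x\<in>verts G. \<forall>y\<in>verts G. signed_adj G x y = signed_adj H (f x) (f y)))"
proof -
  have "({x, y} \<in> edges G \<longleftrightarrow> {f x, f y} \<in> edges H) \<and>
      ({x, y} \<in> edges G \<longrightarrow> sigma G {x, y} = sigma H {f x, f y})
    \<longleftrightarrow> signed_adj G x y = signed_adj H (f x) (f y)" for f x y
    using sigma_edge[OF assms(1), of x y] sigma_edge[OF assms(2), of "f x" "f y"]
    by (auto simp: signed_adj_def)
  then show ?thesis by (simp add: isomorphic_def)
qed

lemma switching_equivalent_iff:
  assumes "is_signed_graph G" "is_signed_graph H"
  shows "G \<sim>\<^sub>s H \<longleftrightarrow> (\<exists>U f. U \<subseteq> verts G \<and> bij_betw f (verts G) (verts H) \<and>
    (\<forall>x\<in>verts G. \<forall>y\<in>verts G.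
      switch_sign U x * switch_sign U y * signed_adj G x y = signed_adj H (f x) (f y)))"
proof -
  have verts: "verts (switch G U) = verts G" for U by (simp add: switch_def)
  show ?thesis
    using is_signed_graph_switch[OF assms(1)] assms(2)
    by (auto simp: switching_equivalent_def isomorphic_iff_signed_adj verts signed_adj_switch)
qed

lemma verts_G1_0: "verts (G1_0 b) = {..<b + 3}"
  by (auto simp: G1_0_def)

lemma is_signed_graph_G1_0: "is_signed_graph (G1_0 b)"
proof -
  have "\<exists>x\<in>{..<b + 3}. \<exists>y\<in>{..<b + 3}. x \<noteq> y \<and> e = {x, y}" if "e \<in> edges (G1_0 b)" for e
    using that unfolding G1_0_def by force
  moreover have "sigma (G1_0 b) e \<in> {-1, 1}" for e by (simp add: G1_0_def)
  ultimately show ?thesis by (simp add: is_signed_graph_def verts_G1_0)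
qed

lemma signed_adj_G1_0:
  assumes "x < b + 3" "y < b + 3"
  shows "signed_adj (G1_0 b) x y =
    (if x = y \<or> x = 0 \<and> 3 \<le> y \<or> y = 0 \<and> 3 \<le> x then 0
     else if x = 0 \<and> y = 1 \<or> x = 1 \<and> y = 0 then -1 else 1)"
proof -
  have "{x, y} \<in> {{x, y} | x y. x < b + 3 \<and> y < b + 3 \<and> x \<noteq> y} \<longleftrightarrow> x \<noteq> y"
    using assms by (force simp: doubleton_eq_iff)
  moreover have "{x, y} \<in> {{0, z} | z. z \<in> {3..<b + 3}} \<longleftrightarrow> x = 0 \<and> 3 \<le> y \<or> y = 0 \<and> 3 \<le> x"
    using assms by (force simp: doubleton_eq_iff)
  ultimately have "{x, y} \<in> edges (G1_0 b) \<longleftrightarrow>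
      \<not> (x = y \<or> x = 0 \<and> 3 \<le> y \<or> y = 0 \<and> 3 \<le> x)"
    unfolding G1_0_def by (simp only: signed_graph.simps Diff_iff) blast
  moreover have "sigma (G1_0 b) {x, y} = (if x = 0 \<and> y = 1 \<or> x = 1 \<and> y = 0 then -1 else 1)"
    by (simp add: G1_0_def doubleton_eq_iff)
  ultimately show ?thesis by (simp add: signed_adj_def)
qed

text \<open>The eigenvector is the indicator of all vertices but 0. In row 0 the entries -1 and 1 at
  vertices 1 and 2 cancel; any other row has \<open>b + 1\<close> ones outside column 0.\<close>

lemma G1_0_eigenvector:
  assumes "x < b + 3"
  shows "(\<Sum>y<b + 3. signed_adj (G1_0 b) x y * of_bool (y \<noteq> 0)) = real (b + 1) * of_bool (x \<noteq> 0)"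
proof (cases "x = 0")
  case True
  have "(\<Sum>y<b + 3. signed_adj (G1_0 b) x y * of_bool (y \<noteq> 0))
      = (\<Sum>y<b + 3. (if y = 2 then 1 else 0) - (if y = 1 then 1 else 0))"
    using True assms by (intro sum.cong) (auto simp: signed_adj_G1_0)
  also have "\<dots> = 0" by (simp add: sum_subtractf)
  finally show ?thesis using True by simp
next
  case False
  have "(\<Sum>y<b + 3. signed_adj (G1_0 b) x y * of_bool (y \<noteq> 0))
      = (\<Sum>y<b + 3. 1 - (if y = 0 then 1 else 0) - (if y = x then 1 else 0))"
    using False assms by (intro sum.cong) (auto simp: signed_adj_G1_0)
  also have "\<dots> = real (b + 1)" using assms by (simp add: sum_subtractf)
  finally show ?thesis using False by simp
qed

section \<open>Eigenvalues of the adjacency matrix and the spectral radius\<close>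

lemma vertex_list:
  assumes "finite (verts G)"
  shows "distinct (vertex_list G)" "set (vertex_list G) = verts G"
proof -
  have "\<exists>xs. distinct xs \<and> set xs = verts G" using finite_distinct_list[OF assms] by blast
  from someI_ex[OF this] show "distinct (vertex_list G)" "set (vertex_list G) = verts G"
    by (simp_all add: vertex_list_def)
qed

text \<open>The enumeration \<open>vertex_list G\<close> identifies vectors with functions on the
  vertices, and sums over \<open>verts G\<close> do not see its order.\<close>

lemma eigenvalue_adjacency_matrix_iff:
  assumes fin: "finite (verts G)"
  shows "eigenvalue (adjacency_matrix G) k \<longleftrightarrow> (\<exists>x. (\<exists>i\<in>verts G. x i \<noteq> 0) \<and>
    (\<forall>i\<in>verts G. (\<Sum>j\<in>verts G. of_real (signed_adj G i j) * x j) = k * x i))"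
proof -
  define xs where "xs = vertex_list G"
  define N where "N = length xs"
  define A where "A = adjacency_matrix G"
  have xs: "distinct xs" "set xs = verts G" using vertex_list[OF fin] by (simp_all add: xs_def)
  have bij: "bij_betw ((!) xs) {..<N} (verts G)"
    using bij_betw_nth[OF xs(1) refl xs(2)[symmetric]] by (simp add: N_def)
  have all: "(\<forall>i\<in>verts G. P i) \<longleftrightarrow> (\<forall>i<N. P (xs ! i))" for P
    using bij by (metis bij_betw_iff_bijections lessThan_iff)
  have A: "dim_row A = N" "dim_col A = N"
    by (simp_all add: A_def adjacency_matrix_def Let_def N_def xs_def)
  have A_index: "A $$ (i, j) = of_real (signed_adj G (xs ! i) (xs ! j))" if "i < N" "j < N" for i j
    using that by (simp add: A_def adjacency_matrix_def Let_def N_def xs_def signed_adj_def)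
  have row: "(A *\<^sub>v vec N (\<lambda>i. x (xs ! i))) $ i
      = (\<Sum>j\<in>verts G. of_real (signed_adj G (xs ! i) j) * x j)" if "i < N" for x i
  proof -
    have "(A *\<^sub>v vec N (\<lambda>i. x (xs ! i))) $ i
        = (\<Sum>j\<in>{..<N}. of_real (signed_adj G (xs ! i) (xs ! j)) * x (xs ! j))"
      using that A by (auto simp: scalar_prod_def A_index atLeast0LessThan intro!: sum.cong)
    then show ?thesis
      using sum.reindex_bij_betw[OF bij, of "\<lambda>j. of_real (signed_adj G (xs ! i) j) * x j"] by simp
  qed
  have eigenvector: "eigenvector A (vec N (\<lambda>i. x (xs ! i))) k \<longleftrightarrow> (\<exists>i\<in>verts G. x i \<noteq> 0) \<and>
    (\<forall>i\<in>verts G. (\<Sum>j\<in>verts G. of_real (signed_adj G i j) * x j) = k * x i)" for x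
  proof -
    have "vec N (\<lambda>i. x (xs ! i)) = 0\<^sub>v N \<longleftrightarrow> (\<forall>i\<in>verts G. x i = 0)"
      unfolding all by (auto simp: vec_eq_iff)
    moreover have "A *\<^sub>v vec N (\<lambda>i. x (xs ! i)) = k \<cdot>\<^sub>v vec N (\<lambda>i. x (xs ! i)) \<longleftrightarrow>
        (\<forall>i\<in>verts G. (\<Sum>j\<in>verts G. of_real (signed_adj G i j) * x j) = k * x i)"
      unfolding all using A by (auto simp: vec_eq_iff row simp del: index_mult_mat_vec)
    ultimately show ?thesis by (auto simp: eigenvector_def A)
  qed
  \<comment> \<open>Every vector arises from a function on the vertices, by reading its entries
    through the inverse of the enumeration.\<close>
  have "\<exists>x. v = vec N (\<lambda>i. x (xs ! i))" if "v \<in> carrier_vec N" for v :: "complex vec"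
  proof
    show "v = vec N (\<lambda>i. (\<lambda>a. v $ the_inv_into {..<N} ((!) xs) a) (xs ! i))"
      using that bij by (auto simp: bij_betw_def the_inv_into_f_f)
  qed
  then have "eigenvalue A k \<longleftrightarrow> (\<exists>x. eigenvector A (vec N (\<lambda>i. x (xs ! i))) k)"
    unfolding eigenvalue_def by (metis A(1) eigenvector_def)
  then show ?thesis unfolding A_def[symmetric] by (simp only: eigenvector)
qed

text \<open>Symmetry makes the Hermitian form \<open>h\<close> of \<open>x\<close> real, hence also
  \<open>k\<close>. The real and imaginary parts of \<open>x\<close> then solve the equations
  separately, and one of them is nonzero.\<close>

lemma real_eigenvector:
  fixes a :: "'a \<Rightarrow> 'a \<Rightarrow> real" and x :: "'a \<Rightarrow> complex"
  assumes "finite V" and sym: "\<And>i j. a i j = a j i" and nz: "\<exists>i\<in>V. x i \<noteq> 0"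
    and eigen: "\<forall>i\<in>V. (\<Sum>j\<in>V. of_real (a i j) * x j) = k * x i"
  obtains y :: "'a \<Rightarrow> real" and l where "\<bar>l\<bar> = cmod k" "\<exists>i\<in>V. y i \<noteq> 0"
    "\<forall>i\<in>V. (\<Sum>j\<in>V. a i j * y j) = l * y i"
proof -
  define h where "h = (\<Sum>i\<in>V. cnj (x i) * (\<Sum>j\<in>V. of_real (a i j) * x j))"
  define N where "N = (\<Sum>i\<in>V. (cmod (x i))\<^sup>2)"
  have "N > 0" unfolding N_def using nz assms(1) by (auto intro!: sum_pos2)
  have "h = (\<Sum>i\<in>V. \<Sum>j\<in>V. of_real (a i j) * x j * cnj (x i))"
    by (simp add: h_def sum_distrib_left mult_ac)
  also have "\<dots> = (\<Sum>i\<in>V. \<Sum>j\<in>V. of_real (a i j) * x i * cnj (x j))"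
    by (subst sum.swap) (simp add: sym)
  also have "\<dots> = cnj h"
    by (simp add: h_def sum_distrib_left mult_ac)
  finally have "Im h = 0" by (metis complex_cnj_cancel_iff Reals_cnj_iff complex_is_Real_iff)
  have "h = (\<Sum>i\<in>V. cnj (x i) * (k * x i))"
    unfolding h_def using eigen by (intro sum.cong) auto
  also have "\<dots> = k * of_real N"
    unfolding N_def of_real_sum sum_distrib_left
    by (intro sum.cong) (auto simp: complex_norm_square mult_ac simp del: of_real_power)
  finally have "Im k = 0" using \<open>Im h = 0\<close> \<open>N > 0\<close> by simp
  then have k: "k = of_real (Re k)" by (simp add: complex_eq_iff)
  have abs: "\<bar>Re k\<bar> = cmod k" by (subst k) simp
  have "(\<Sum>j\<in>V. a i j * Re (x j)) = Re k * Re (x i)"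
    "(\<Sum>j\<in>V. a i j * Im (x j)) = Re k * Im (x i)" if "i \<in> V" for i
    using arg_cong[OF bspec[OF eigen that], of Re] arg_cong[OF bspec[OF eigen that], of Im] \<open>Im k = 0\<close>
    by simp_all
  moreover have "(\<exists>i\<in>V. Re (x i) \<noteq> 0) \<or> (\<exists>i\<in>V. Im (x i) \<noteq> 0)"
    using nz by (auto simp: complex_eq_iff)
  ultimately show thesis
    using abs that[of "Re k" "\<lambda>i. Re (x i)"] that[of "Re k" "\<lambda>i. Im (x i)"] by blast
qed

text \<open>The spectral radius is attained by some eigenvalue, which symmetry makes real; its sign
  is unknown, hence the absolute value.\<close>

lemma rho_eigenvector:
  assumes "finite (verts G)" "verts G \<noteq> {}"
  obtains y :: "'a \<Rightarrow> real" and l where "\<bar>l\<bar> = rho (G :: 'a signed_graph)" "\<exists>i\<in>verts G. y i \<noteq> 0"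
    "\<forall>i\<in>verts G. (\<Sum>j\<in>verts G. signed_adj G i j * y j) = l * y i"
proof -
  have A: "adjacency_matrix G \<in> carrier_mat (length (vertex_list G)) (length (vertex_list G))"
    by (simp add: adjacency_matrix_def Let_def)
  \<comment> \<open>A matrix of dimension 0 has no eigenvalues at all.\<close>
  have "length (vertex_list G) > 0" using vertex_list(2)[OF assms(1)] assms(2) by auto
  then obtain k where "rho G = cmod k" "eigenvalue (adjacency_matrix G) k"
    using spectral_radius_mem_max(1)[OF A] by (auto simp: rho_def spectrum_def)
  moreover obtain x where x: "\<exists>i\<in>verts G. x i \<noteq> 0"
      "\<forall>i\<in>verts G. (\<Sum>j\<in>verts G. of_real (signed_adj G i j) * x j) = k * x i"
    using calculation(2) unfolding eigenvalue_adjacency_matrix_iff[OF assms(1)] by blast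
  moreover obtain l y where "\<bar>l\<bar> = cmod k" "\<exists>i\<in>verts G. y i \<noteq> 0"
      "\<forall>i\<in>verts G. (\<Sum>j\<in>verts G. signed_adj G i j * y j) = l * y i"
    by (rule real_eigenvector[OF assms(1) signed_adj_sym x])
  ultimately show thesis by (intro that[of l y]) simp_all
qed

lemma eigenvalue_le_rho:
  assumes "finite (verts G)" "\<exists>i\<in>verts G. y i \<noteq> 0"
    and eigen: "\<forall>i\<in>verts G. (\<Sum>j\<in>verts G. signed_adj G i j * y j) = l * y i"
  shows "\<bar>l\<bar> \<le> rho G"
proof -
  have A: "adjacency_matrix G \<in> carrier_mat (length (vertex_list G)) (length (vertex_list G))"
    by (simp add: adjacency_matrix_def Let_def)
  have "length (vertex_list G) > 0" using vertex_list(2)[OF assms(1)] assms(2) by auto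
  moreover have "eigenvalue (adjacency_matrix G) (of_real l)"
    unfolding eigenvalue_adjacency_matrix_iff[OF assms(1)]
    using assms(2) eigen by (intro exI[of _ "\<lambda>i. of_real (y i)"]) (auto simp flip: of_real_mult of_real_sum)
  ultimately show ?thesis
    unfolding rho_def by (intro spectral_radius_mem_max(2)[OF A]) (force simp: spectrum_def)+
qed

section \<open>The upper bound and the case of equality\<close>

lemma rho_bound:
  fixes G :: "'a signed_graph"
  assumes G: "is_signed_graph G" and free: "unbalanced_K4_free G" and unb: "unbalanced G"
    and card: "card (verts G) \<ge> 7"
  defines "k \<equiv> real (card (verts G)) - 2"
  shows "rho G \<le> k"
    and "rho G = k \<Longrightarrow> \<exists>U\<subseteq>verts G.
      near_complete (verts G) (\<lambda>i j. switch_sign U i * switch_sign U j * signed_adj G i j)"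
proof -
  have fin: "finite (verts G)" using G by (simp add: is_signed_graph_def)
  have "verts G \<noteq> {}" using card by auto
  then obtain x l where l: "\<bar>l\<bar> = rho G" and x: "\<exists>i\<in>verts G. x i \<noteq> 0"
    and eigen: "\<forall>i\<in>verts G. (\<Sum>j\<in>verts G. signed_adj G i j * x j) = l * x i"
    by (rule rho_eigenvector[OF fin])
  \<comment> \<open>Switching at the vertices with a negative entry turns \<open>x\<close> into its
    absolute value \<open>y\<close>.\<close>
  define U where "U = {i \<in> verts G. x i < 0}"
  define b where "b = (\<lambda>i j. switch_sign U i * switch_sign U j * signed_adj G i j)"
  define y where "y i = \<bar>x i\<bar>" for i
  interpret K4_balanced "verts G" b
    unfolding b_def
    by (rule K4_balanced.switching[OF K4_balanced_signed_adj[OF G free]]) (rule switch_sign_values)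
  have y_eq: "y i = switch_sign U i * x i" "switch_sign U i * y i = x i" if "i \<in> verts G" for i
    using that by (auto simp: y_def switch_sign_def U_def)
  have y: "\<forall>i\<in>verts G. 0 \<le> y i" "\<exists>i\<in>verts G. y i \<noteq> 0" using x by (auto simp: y_def)
  have eigen_y: "\<forall>i\<in>verts G. (\<Sum>j\<in>verts G. b i j * y j) = l * y i"
  proof
    fix i assume i: "i \<in> verts G"
    have "(\<Sum>j\<in>verts G. b i j * y j) = (\<Sum>j\<in>verts G. switch_sign U i * (signed_adj G i j * x j))"
      by (intro sum.cong) (auto simp: b_def y_eq(2)[symmetric])
    also have "\<dots> = l * y i"
      using eigen i by (simp add: y_eq(1)[OF i] flip: sum_distrib_left)
    finally show "(\<Sum>j\<in>verts G. b i j * y j) = l * y i" .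
  qed
  note form = quadratic_form_eigenvector[OF eigen_y]
  have pos: "0 < (\<Sum>i\<in>verts G. (y i)\<^sup>2)"
    using y fin by (auto intro!: sum_pos2)
  obtain u v where uv: "u \<in> verts G" "v \<in> verts G" "b u v = -1"
    using unbalanced_negative_edge[OF G unb, of "switch_sign U", OF switch_sign_values] unfolding b_def by blast
  \<comment> \<open>The form of an eigenvector is \<open>l\<close> times a positive sum of squares,
    so bounds on the form become bounds on \<open>l\<close>.\<close>
  have "l \<le> k"
    using form_bound(1)[OF y(1) uv] card pos by (simp add: form k_def)
  have "- 3 * l \<le> 2 * real (card (verts G))"
    using negated_form_bound[OF y(1)] pos unfolding form
    by (metis mult.assoc mult_le_cancel_right_pos)
  \<comment> \<open>Two thirds of the number of vertices lie strictly below \<open>k\<close> once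
    there are more than 6 of them.\<close>
  then have "- l < k" using card by (simp add: k_def)
  with \<open>l \<le> k\<close> l show "rho G \<le> k" by linarith
  \<comment> \<open>A negative eigenvalue stays strictly below \<open>k\<close> in modulus, so
    equality means \<open>l = k\<close>.\<close>
  assume "rho G = k"
  with l \<open>- l < k\<close> have "l = k" by linarith
  have "U \<subseteq> verts G" by (auto simp: U_def)
  have "near_complete (verts G) b"
    using \<open>l = k\<close> extremal_structure[OF y _ uv] eigen_y card by (simp add: k_def)
  with \<open>U \<subseteq> verts G\<close> show "\<exists>U\<subseteq>verts G.
      near_complete (verts G) (\<lambda>i j. switch_sign U i * switch_sign U j * signed_adj G i j)"
    unfolding b_def by (intro exI[of _ U] conjI)
qed

text \<open>The vertices other than \<open>c\<close>, \<open>p\<close>, \<open>q\<close> are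
  interchangeable, so any bijection of them onto the numbers from 3 on will do.\<close>

lemma G1_0_isomorphism:
  fixes b :: "'a \<Rightarrow> 'a \<Rightarrow> real"
  assumes "finite V" "\<And>i j. b i j = b j i" "\<And>i. b i i = 0"
    and "near_complete V b"
  shows "\<exists>f. bij_betw f V {..<card V} \<and>
    (\<forall>i\<in>V. \<forall>j\<in>V. b i j = signed_adj (G1_0 (card V - 3)) (f i) (f j))"
proof -
  obtain c p q where V: "c \<in> V" "p \<in> V" "q \<in> V"
    and c: "b c p = -1" "b c q = 1" "\<forall>z\<in>V - {c, p, q}. b c z = 0"
    and complete: "\<forall>i\<in>V - {c}. \<forall>j\<in>V - {c}. i \<noteq> j \<longrightarrow> b i j = 1"
    using assms(4) unfolding near_complete_def by blast
  have distinct: "c \<noteq> p" "c \<noteq> q" "p \<noteq> q" using c assms(3) by auto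
  have "card {c, p, q} \<le> card V" using V assms(1) by (intro card_mono) auto
  then have card: "3 \<le> card V" using distinct by simp
  have "card (V - {c, p, q}) = card {3..<card V}"
    using V distinct assms(1) by (simp add: card_Diff_subset)
  then obtain g where g: "bij_betw g (V - {c, p, q}) {3..<card V}"
    using assms(1) finite_same_card_bij[of "V - {c, p, q}" "{3..<card V}"] by auto
  define f where "f = g(c := 0, p := 1, q := 2)"
  have f: "f c = 0" "f p = 1" "f q = 2" using distinct by (auto simp: f_def)
  have "bij_betw f (V - {c, p, q}) {3..<card V}"
    using g by (rule bij_betw_cong[THEN iffD1, rotated]) (auto simp: f_def)
  moreover have "bij_betw f {c, p, q} {..<3}"
    using f by (auto simp: bij_betw_def inj_on_def)
  ultimately have "bij_betw f ((V - {c, p, q}) \<union> {c, p, q}) ({3..<card V} \<union> {..<3})"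
    by (intro bij_betw_combine) auto
  moreover have "(V - {c, p, q}) \<union> {c, p, q} = V" "{3..<card V} \<union> {..<3} = {..<card V}"
    using V card by auto
  ultimately have bij: "bij_betw f V {..<card V}" by simp
  have rest: "3 \<le> f z" if "z \<in> V - {c, p, q}" for z
    using g that by (auto simp: f_def bij_betw_def)
  \<comment> \<open>Subtraction is truncated; \<open>card\<close> ensures that
    \<open>card V - 3 + 3\<close> is the size of \<open>V\<close>.\<close>
  have lt: "f i < card V - 3 + 3" if "i \<in> V" for i using bij that card by (auto simp: bij_betw_def)
  have eq_iff: "f i = f j \<longleftrightarrow> i = j" if "i \<in> V" "j \<in> V" for i j
    using bij that by (auto simp: bij_betw_def inj_on_def)
  define h where "h = signed_adj (G1_0 (card V - 3))"
  have row_c: "b c j = h 0 (f j)" if j: "j \<in> V" for j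
  proof -
    consider "j = c" | "j = p" | "j = q" | "j \<in> V - {c, p, q}" using j by blast
    then show ?thesis
      using c rest[of j] f lt[OF j] by cases (auto simp: h_def signed_adj_G1_0 assms(3))
  qed
  \<comment> \<open>Entries at \<open>c\<close> follow from \<open>row_c\<close> by symmetry; all
    others are 1 off the diagonal on both sides.\<close>
  have "b i j = h (f i) (f j)" if ij: "i \<in> V" "j \<in> V" for i j
  proof (cases "i = c \<or> j = c")
    case True
    then show ?thesis using row_c ij f assms(2)[of i j] signed_adj_sym by (metis h_def)
  next
    case False
    then have "f i \<noteq> 0" "f j \<noteq> 0" using eq_iff ij V f by metis+
    then show ?thesis
      using False complete ij eq_iff[OF ij] lt ij
      by (cases "i = j") (auto simp: h_def signed_adj_G1_0 assms(3))
  qed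
  then show ?thesis using bij unfolding h_def by blast
qed

text \<open>The eigenvector of \<open>G1_0 b\<close> for \<open>b + 1\<close> is pulled back along
  the isomorphism, with signs that undo the switching.\<close>

lemma rho_ge_of_switching_equivalent:
  assumes G: "is_signed_graph G" and "G \<sim>\<^sub>s G1_0 b"
  shows "real (b + 1) \<le> rho G"
proof -
  have fin: "finite (verts G)" using G by (simp add: is_signed_graph_def)
  obtain U f where bij: "bij_betw f (verts G) {..<b + 3}"
    and f: "\<forall>x\<in>verts G. \<forall>y\<in>verts G.
      switch_sign U x * switch_sign U y * signed_adj G x y = signed_adj (G1_0 b) (f x) (f y)"
    using assms(2) unfolding switching_equivalent_iff[OF G is_signed_graph_G1_0] verts_G1_0 by blast
  define y where "y i = switch_sign U i * of_bool (f i \<noteq> 0)" for i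
  have "(\<Sum>j\<in>verts G. signed_adj G i j * y j) = real (b + 1) * y i" if i: "i \<in> verts G" for i
  proof -
    have "signed_adj G i j * y j
        = switch_sign U i * (signed_adj (G1_0 b) (f i) (f j) * of_bool (f j \<noteq> 0))"
      if j: "j \<in> verts G" for j
      using f[rule_format, OF i j, symmetric] by (auto simp: y_def switch_sign_def)
    then have "(\<Sum>j\<in>verts G. signed_adj G i j * y j)
      = switch_sign U i * (\<Sum>j\<in>verts G. signed_adj (G1_0 b) (f i) (f j) * of_bool (f j \<noteq> 0))"
      by (simp add: sum_distrib_left)
    also have "\<dots> = switch_sign U i * (\<Sum>m<b + 3. signed_adj (G1_0 b) (f i) m * of_bool (m \<noteq> 0))"
      by (subst sum.reindex_bij_betw[OF bij, symmetric]) simp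
    also have "\<dots> = real (b + 1) * y i"
      using bij i by (subst G1_0_eigenvector) (auto simp: bij_betw_def y_def)
    finally show ?thesis .
  qed
  \<comment> \<open>Vertex 1 of \<open>G1_0 b\<close> has entry 1, so its preimage shows that
    \<open>y\<close> is nonzero.\<close>
  moreover obtain i where "i \<in> verts G" "f i = 1"
    using bij by (metis bij_betw_iff_bijections lessThan_iff one_less_numeral_iff semiring_norm(77) trans_less_add2)
  then have "\<exists>i\<in>verts G. y i \<noteq> 0" by (intro bexI[of _ i]) (auto simp: y_def switch_sign_def)
  ultimately have "\<bar>real (b + 1)\<bar> \<le> rho G"
    by (intro eigenvalue_le_rho[OF fin]) auto
  then show ?thesis by simp
qed

theorem theorem1p6:
  fixes G :: "'a signed_graph" and n :: nat
  assumes "is_signed_graph G"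
    and "card (verts G) = n"
    and "n \<ge> 7"
    and "unbalanced_K4_free G"
    and "unbalanced G"
  shows "rho G \<le> real n - 2 \<and> (rho G = real n - 2 \<longleftrightarrow> G \<sim>\<^sub>s G1_0 (n - 3))"
proof -
  note G = assms(1,4,5) and card = assms(2,3)
  have fin: "finite (verts G)" using G(1) by (simp add: is_signed_graph_def)
  have le: "rho G \<le> real n - 2"
    using rho_bound(1)[OF G] card by simp
  have "G \<sim>\<^sub>s G1_0 (n - 3)" if eq: "rho G = real n - 2"
  proof -
    obtain U where U: "U \<subseteq> verts G"
      and ex: "near_complete (verts G) (\<lambda>i j. switch_sign U i * switch_sign U j * signed_adj G i j)"
      using rho_bound(2)[OF G] card eq by auto
    have "\<exists>f. bij_betw f (verts G) {..<card (verts G)} \<and> (\<forall>i\<in>verts G. \<forall>j\<in>verts G.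
      switch_sign U i * switch_sign U j * signed_adj G i j
        = signed_adj (G1_0 (card (verts G) - 3)) (f i) (f j))"
    proof (rule G1_0_isomorphism[where b = "\<lambda>i j. switch_sign U i * switch_sign U j * signed_adj G i j"])
      show "switch_sign U i * switch_sign U i * signed_adj G i i = 0" for i
        using K4_balanced.irrefl[OF K4_balanced_signed_adj[OF G(1,2)]] by simp
      show "switch_sign U i * switch_sign U j * signed_adj G i j
        = switch_sign U j * switch_sign U i * signed_adj G j i" for i j
        by (simp add: signed_adj_sym[of G i j])
    qed (fact fin ex)+
    moreover have "{..<card (verts G)} = verts (G1_0 (n - 3))" using card by (simp add: verts_G1_0)
    ultimately show ?thesis
      unfolding switching_equivalent_iff[OF G(1) is_signed_graph_G1_0] using U card by metis
  qed
  \<comment> \<open>For \<open>b = n - 3\<close> the eigenvalue \<open>b + 1\<close> is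
    \<open>n - 2\<close>, which meets the upper bound.\<close>
  moreover have "rho G = real n - 2" if "G \<sim>\<^sub>s G1_0 (n - 3)"
    using rho_ge_of_switching_equivalent[OF G(1) that] le card by (simp add: of_nat_diff)
  ultimately show ?thesis using le by blast
qed

end
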